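(* For $d\ge 3$ let $\Omega_d$ be the set of finite simple graphs on the vertex set $[d]=\{1,\dots,d\}$, let $K_d$ be the complete graph on $[d]$, and for $G\in\Omega_d$ let $\varepsilon(G)$ be the number of edges (1-dimensional faces) of the edge polytope $\mathcal{P}_G$. Then: (a) If $3\le d\le 13$ and $G\in\Omega_d$ with $G\neq K_d$, then $\varepsilon(G)<\varepsilon(K_d)$. (b) If $G\in\Omega_{14}$ with $G\neq K_{14}$, then $\varepsilon(G)\le\varepsilon(K_{14})$. Moreover, $\varepsilon(G)=\varepsilon(K_{14})$ if and only if $G=K_{14}-K_{4,5}$ or $G=K_{14}-K_{5,5}$, i.e. if and only if the complement of $G$ (the graph on $[14]$ whose edges are the non-edges of $G$) is a complete bipartite graph $K_{4,5}$ together with $5$ isolated vertices, or a complete bipartite graph $K_{5,5}$ together with $4$ isolated vertices. (c) If $d\ge 15$, then there exists $G\in\Omega_d$ such that $\varepsilon(G)>\varepsilon(K_d)$.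
   Context: For $G\in\Omega_d$ with edge set $E(G)$ and $e=\{i,j\}\in E(G)$, set $\rho(e)=\mathbf{e}_i+\mathbf{e}_j\in\mathbb{R}^d$, where $\mathbf{e}_i$ is the $i$th unit coordinate vector. The edge polytope $\mathcal{P}_G$ is the convex hull of $\{\rho(e): e\in E(G)\}$ in $\mathbb{R}^d$. For a graph $H$ whose vertex set is contained in $[d]$, $K_d-H$ denotes the graph on $[d]$ with edge set $E(K_d)\setminus E(H)$; $K_{m,n}$ denotes the complete bipartite graph with parts of sizes $m$ and $n$. *)

theory Defs
  imports "HOL-Analysis.Analysis"
begin

text \<open>
  The vertex set \<open>[d]\<close> is rendered as the universe of a finite type \<open>'n\<close> with \<open>CARD('n) = d\<close>, so
  that \<open>\<real>\<^sup>d\<close> is \<^typ>\<open>real ^ 'n\<close>. As the vertex set is fixed, a graph is identified with its set of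
  edges, an edge being a two-element set of vertices.
\<close>

definition simple_graphs :: "'n::finite set set set" (\<open>\<Omega>\<close>) where
  "\<Omega> = {G. \<forall>e\<in>G. card e = 2}"

definition complete_graph :: "'n::finite set set" where
  "complete_graph = {e. card e = 2}"

definition complete_bipartite :: "'n::finite set \<Rightarrow> 'n set \<Rightarrow> 'n set set" where
  "complete_bipartite A B = {{a, b} | a b. a \<in> A \<and> b \<in> B}"

text \<open>
  The graph \<open>G\<close> is \<open>K\<^sub>d - H\<close> for some copy \<open>H\<close> of \<open>K\<^sub>m\<^sub>,\<^sub>n\<close> with vertices in \<open>[d]\<close>.
\<close>

definition is_complete_minus_bipartite :: "nat \<Rightarrow> nat \<Rightarrow> 'n::finite set set \<Rightarrow> bool" where
  "is_complete_minus_bipartite m n G \<longleftrightarrow>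
     (\<exists>A B. A \<inter> B = {} \<and> card A = m \<and> card B = n \<and>
            G = complete_graph - complete_bipartite A B)"

definition \<rho> :: "'n::finite set \<Rightarrow> real ^ 'n" where
  "\<rho> e = (\<Sum>i\<in>e. axis i 1)"

definition edge_polytope :: "'n::finite set set \<Rightarrow> (real ^ 'n) set" where
  "edge_polytope G = convex hull (\<rho> ` G)"

definition \<epsilon> :: "'n::finite set set \<Rightarrow> nat" where
  "\<epsilon> G = card {F. F edge_of edge_polytope G}"

end

theory Submission
  imports Defs
begin

text \<open>
  Two vertices \<open>\<rho> e\<close>, \<open>\<rho> f\<close> of the edge polytope always span an edge if \<open>e\<close> and \<open>f\<close> meet; if they are
  disjoint, they span one iff \<open>{e, f}\<close> is the only perfect matching of \<open>G\<close> on \<open>e \<union> f\<close>. Hence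
  \<open>\<epsilon>(K\<^sub>d) - \<epsilon>(G)\<close> counts the pairs of adjacent edges of \<open>K\<^sub>d\<close> meeting the complement \<open>H\<close> of \<open>G\<close>, minus
  the four-sets with a unique perfect matching in \<open>G\<close>. In such a four-set, the edges of \<open>H\<close> form a path
  with two or three edges or a four-cycle.

  Both counts are distributed over the edges of \<open>H\<close>. Suppose that \<open>uv\<close> is an edge of \<open>H\<close> and that \<open>a\<close>,
  \<open>b\<close>, \<open>c\<close>, \<open>z\<close> of the remaining \<open>d - 2\<close> vertices are \<open>H\<close>-adjacent to \<open>u\<close> only, to \<open>v\<close> only, to both, to
  neither. The first count charges \<open>2(d - 2) - (a + b)/2 - c\<close> to \<open>uv\<close>. Splitting each four-set suitably,
  the second charges at most \<open>z(a + b)/2 + ab/4\<close>. For \<open>d \<le> 14\<close> this never exceeds the former, and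
  equality forces \<open>d = 14\<close>, \<open>c = 0\<close> and \<open>{a, b} = {3, 4}\<close> or \<open>a = b = 4\<close>. If every edge of \<open>H\<close> is tight,
  each nontrivial component of \<open>H\<close> is \<open>K\<^sub>4\<^sub>,\<^sub>5\<close> or \<open>K\<^sub>5\<^sub>,\<^sub>5\<close>, and 14 vertices hold only one. For
  \<open>d \<ge> 15\<close> the same computation shows that \<open>H = K\<^sub>5\<^sub>,\<^sub>5\<close> beats \<open>K\<^sub>d\<close>.
\<close>

subsection \<open>Edges of the edge polytope\<close>

lemma inner_\<rho>: "c \<bullet> \<rho> e = (\<Sum>i\<in>e. c $ i)"
  by (simp add: \<rho>_def inner_sum_right inner_axis)

lemma \<rho>_nth: "\<rho> e $ i = of_bool (i \<in> e)"
  by (simp add: \<rho>_def axis_def if_distrib of_bool_def cong: if_cong)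

lemma inj_\<rho>: "inj \<rho>"
proof (rule injI)
  fix e f :: "'n::finite set"
  assume "\<rho> e = \<rho> f"
  then have "i \<in> e \<longleftrightarrow> i \<in> f" for i
    using \<rho>_nth[of e i] \<rho>_nth[of f i] by (simp split: if_splits add: of_bool_def)
  then show "e = f" by auto
qed

text \<open>The affine hull of \<open>\<rho> e\<close> and \<open>\<rho> f\<close> lies in the
  hyperplane where the functional \<open>c\<close> equals \<open>b\<close>, while the hull of the
  other generators lies strictly below it. The two are disjoint, so
  \<open>face_of_convex_hulls\<close> applies.\<close>

lemma face_of_edge_polytopeI:
  fixes c :: "'n::finite \<Rightarrow> real"
  assumes "e \<in> G" "f \<in> G"
    and e: "(\<Sum>i\<in>e. c i) = b" and f: "(\<Sum>i\<in>f. c i) = b"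
    and less: "\<And>g. g \<in> G \<Longrightarrow> g \<noteq> e \<Longrightarrow> g \<noteq> f \<Longrightarrow> (\<Sum>i\<in>g. c i) < b"
  shows "closed_segment (\<rho> e) (\<rho> f) face_of edge_polytope G"
proof -
  define a where "a = (\<chi> i. c i)"
  have a: "a \<bullet> \<rho> g = (\<Sum>i\<in>g. c i)" for g
    by (simp add: inner_\<rho> a_def)
  have "affine hull {\<rho> e, \<rho> f} \<subseteq> {x. a \<bullet> x = b}"
    using e f a by (intro hull_minimal affine_hyperplane) auto
  moreover have "convex hull (\<rho> ` G - {\<rho> e, \<rho> f}) \<subseteq> {x. a \<bullet> x < b}"
  proof (intro hull_minimal convex_halfspace_lt subsetI)
    fix x assume "x \<in> \<rho> ` G - {\<rho> e, \<rho> f}"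
    then obtain g where "x = \<rho> g" "g \<in> G" "g \<noteq> e" "g \<noteq> f" by blast
    then show "x \<in> {x. a \<bullet> x < b}" using less by (simp add: a)
  qed
  ultimately have "affine hull {\<rho> e, \<rho> f} \<inter> convex hull (\<rho> ` G - {\<rho> e, \<rho> f}) = {}"
    by fastforce
  then show ?thesis
    using assms(1,2)
    unfolding edge_polytope_def segment_convex_hull by (intro face_of_convex_hulls) auto
qed

lemma cherry_face_of:
  assumes G: "G \<in> \<Omega>" and vx: "{v, x} \<in> G" "{v, y} \<in> G" "v \<noteq> x" "v \<noteq> y" "x \<noteq> y"
  shows "closed_segment (\<rho> {v, x}) (\<rho> {v, y}) face_of edge_polytope G"
\<comment> \<open>Weighting the centre \<open>v\<close> by 2 and the tips by 1 gives both edges the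
  value 3. Every other pair of vertices, including \<open>{x, y}\<close>, gets at most 2.\<close>
proof (rule face_of_edge_polytopeI[where b = 3
    and c = "\<lambda>i. if i = v then 2 else if i = x \<or> i = y then 1 else 0"])
  fix g assume g: "g \<in> G" "g \<noteq> {v, x}" "g \<noteq> {v, y}"
  obtain p q where "g = {p, q}" "p \<noteq> q"
    using G g unfolding simple_graphs_def by (metis (mono_tags, lifting) card_2_iff mem_Collect_eq)
  with g vx show "(\<Sum>i\<in>g. if i = v then 2 else if i = x \<or> i = y then 1 else 0) < (3 :: real)"
    by (auto simp: insert_commute)
qed (use vx in auto)

lemma matching_face_of:
  assumes G: "G \<in> \<Omega>" and e: "{i, j} \<in> G" "{k, l} \<in> G" "{i, k} \<notin> G" "{i, l} \<notin> G"
    and distinct: "distinct [i, j, k, l]"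
  shows "closed_segment (\<rho> {i, j}) (\<rho> {k, l}) face_of edge_polytope G"
\<comment> \<open>Only the missing pairs \<open>{i, k}\<close> and \<open>{i, l}\<close> exceed the
  value 2 of the two chosen edges. All remaining pairs get at most 1.\<close>
proof (rule face_of_edge_polytopeI[where b = 2
    and c = "\<lambda>m. if m = i then 2 else if m = j then 0 else if m = k \<or> m = l then 1 else - 1"])
  fix g assume g: "g \<in> G" "g \<noteq> {i, j}" "g \<noteq> {k, l}"
  obtain p q where pq: "g = {p, q}" "p \<noteq> q"
    using G g unfolding simple_graphs_def by (metis (mono_tags, lifting) card_2_iff mem_Collect_eq)
  have "{p, q} \<noteq> {i, k}" "{p, q} \<noteq> {i, l}" "{p, q} \<noteq> {i, j}" "{p, q} \<noteq> {k, l}"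
    using g e pq by metis+
  with pq distinct show "(\<Sum>m\<in>g. if m = i then 2 else if m = j then 0
      else if m = k \<or> m = l then 1 else - 1) < (2 :: real)"
    by (auto simp: doubleton_eq_iff)
qed (use assms in auto)

text \<open>Two perfect matchings on the same four vertices give segments with a common midpoint. A
  face containing the first segment would therefore contain the ends of the second.\<close>

lemma matching_not_face_of:
  assumes G: "{i, k} \<in> G" "{j, l} \<in> G" and distinct: "distinct [i, j, k, l]"
  shows "\<not> closed_segment (\<rho> {i, j}) (\<rho> {k, l}) face_of edge_polytope G"
proof
  assume face: "closed_segment (\<rho> {i, j}) (\<rho> {k, l}) face_of edge_polytope G"
  have "\<rho> {i, j} + \<rho> {k, l} = \<rho> {i, k} + \<rho> {j, l}"
    using distinct by (simp add: \<rho>_def algebra_simps)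
  then have mid: "midpoint (\<rho> {i, j}) (\<rho> {k, l}) = midpoint (\<rho> {i, k}) (\<rho> {j, l})"
    by (simp add: midpoint_def)
  have "\<rho> {i, k} \<noteq> \<rho> {j, l}"
    using distinct by (auto simp: inj_eq[OF inj_\<rho>] doubleton_eq_iff)
  then have "midpoint (\<rho> {i, j}) (\<rho> {k, l}) \<in> open_segment (\<rho> {i, k}) (\<rho> {j, l})"
    by (simp add: mid)
  moreover have "\<rho> {i, k} \<in> edge_polytope G" "\<rho> {j, l} \<in> edge_polytope G"
    using G by (auto simp: edge_polytope_def intro: hull_inc)
  ultimately have "\<rho> {i, k} \<in> closed_segment (\<rho> {i, j}) (\<rho> {k, l})"
    using face by (meson face_ofD midpoint_in_closed_segment)
  then obtain t where "\<rho> {i, k} = (1 - t) *\<^sub>R \<rho> {i, j} + t *\<^sub>R \<rho> {k, l}"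
    by (auto simp: closed_segment_def)
  \<comment> \<open>Coordinate \<open>i\<close> forces \<open>t = 0\<close>, coordinate
    \<open>k\<close> forces \<open>t = 1\<close>.\<close>
  from arg_cong[OF this, of "\<lambda>x. x $ i"] arg_cong[OF this, of "\<lambda>x. x $ k"] distinct
  show False by (auto simp: \<rho>_nth)
qed

lemma closed_segment_edge_of:
  assumes "closed_segment (\<rho> e) (\<rho> f) face_of edge_polytope G" "e \<noteq> f"
  shows "closed_segment (\<rho> e) (\<rho> f) edge_of edge_polytope G"
  using assms
  by (simp add: edge_of_def segment_convex_hull aff_dim_convex_hull aff_dim_2 inj_eq[OF inj_\<rho>])

text \<open>A one-dimensional face of a polytope is a compact convex collinear set, hence a segment.
  Its ends are extreme points of the polytope, and these are among the generators.\<close>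

lemma edge_of_edge_polytopeE:
  assumes F: "F edge_of edge_polytope G"
  obtains e f where "e \<in> G" "f \<in> G" "e \<noteq> f" "F = closed_segment (\<rho> e) (\<rho> f)"
    and "closed_segment (\<rho> e) (\<rho> f) face_of edge_polytope G"
proof -
  from F have face: "F face_of edge_polytope G" and dim: "aff_dim F = 1"
    by (auto simp: edge_of_def)
  have "compact F"
    using face by (rule face_of_imp_compact[rotated 2])
      (auto simp: edge_polytope_def intro: finite_imp_compact_convex_hull)
  moreover have "convex F" "F \<noteq> {}" "collinear F"
    using face dim by (auto simp: face_of_imp_convex collinear_aff_dim)
  ultimately obtain p q where pq: "F = closed_segment p q"
    using compact_convex_collinear_segment by blast
  with dim have "p \<noteq> q" by auto
  have "p extreme_point_of edge_polytope G" "q extreme_point_of edge_polytope G"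
    using face extreme_point_of_face[OF face] by (auto simp: pq extreme_point_of_segment)
  then have "p \<in> \<rho> ` G" "q \<in> \<rho> ` G"
    unfolding edge_polytope_def by (auto intro: extreme_point_of_convex_hull)
  with \<open>p \<noteq> q\<close> pq face that show thesis
    by (metis imageE)
qed

section \<open>Counting polytope edges by ordered tuples of vertices\<close>

definition cherries :: "'n::finite set set \<Rightarrow> ('n \<times> 'n \<times> 'n) set" where
  "cherries G = {(v, x, y). distinct [v, x, y] \<and> {v, x} \<in> G \<and> {v, y} \<in> G}"

text \<open>The tuple lists a four-cycle in cyclic order: its diagonals form the matching in
  question, its two pairs of opposite sides the competing ones.\<close>

definition unique_matchings :: "'n::finite set set \<Rightarrow> ('n \<times> 'n \<times> 'n \<times> 'n) set" where
  "unique_matchings G = {(u, v, w, z). distinct [u, v, w, z] \<and> {u, w} \<in> G \<and> {v, z} \<in> G \<and>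
     \<not> ({u, v} \<in> G \<and> {w, z} \<in> G) \<and> \<not> ({v, w} \<in> G \<and> {z, u} \<in> G)}"

text \<open>This symmetry and \<open>unique_matchings_swap\<close> are reflections of the square
  that generate its dihedral group of order 8.\<close>

lemma unique_matchings_reflect:
  "(u, v, w, z) \<in> unique_matchings G \<Longrightarrow> (w, v, u, z) \<in> unique_matchings G"
  by (simp add: unique_matchings_def insert_commute) metis

lemma unique_matchings_swap:
  "(u, v, w, z) \<in> unique_matchings G \<Longrightarrow> (v, u, z, w) \<in> unique_matchings G"
  by (simp add: unique_matchings_def insert_commute) metis

lemma unique_matching_face_of_iff:
  assumes G: "G \<in> \<Omega>" and e: "{u, w} \<in> G" "{v, z} \<in> G" and distinct: "distinct [u, v, w, z]"
  shows "closed_segment (\<rho> {u, w}) (\<rho> {v, z}) face_of edge_polytope G \<longleftrightarrow>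
    \<not> ({u, v} \<in> G \<and> {w, z} \<in> G) \<and> \<not> ({v, w} \<in> G \<and> {z, u} \<in> G)"
proof
  assume face: "closed_segment (\<rho> {u, w}) (\<rho> {v, z}) face_of edge_polytope G"
  have "\<not> ({u, v} \<in> G \<and> {w, z} \<in> G)"
    using matching_not_face_of[of u v G w z] distinct face by auto
  moreover have "\<not> ({u, z} \<in> G \<and> {w, v} \<in> G)"
    using matching_not_face_of[of u z G w v] distinct face by (auto simp: insert_commute)
  ultimately show "\<not> ({u, v} \<in> G \<and> {w, z} \<in> G) \<and> \<not> ({v, w} \<in> G \<and> {z, u} \<in> G)"
    by (auto simp: insert_commute)
next
  have wu: "{w, u} \<in> G" and zv: "{z, v} \<in> G" using e by (simp_all add: insert_commute)
  note rules = matching_face_of[OF G e] matching_face_of[OF G wu e(2)]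
    matching_face_of[OF G e(2,1)] matching_face_of[OF G zv e(1)]
  assume "\<not> ({u, v} \<in> G \<and> {w, z} \<in> G) \<and> \<not> ({v, w} \<in> G \<and> {z, u} \<in> G)"
  \<comment> \<open>Each competing matching lacks a side. Sides from different matchings are
    adjacent, so the two missing ones share a corner, which takes the role of \<open>i\<close> in
    \<open>matching_face_of\<close>.\<close>
  then consider "{u, v} \<notin> G" "{u, z} \<notin> G" | "{w, v} \<notin> G" "{w, z} \<notin> G"
    | "{v, u} \<notin> G" "{v, w} \<notin> G" | "{z, u} \<notin> G" "{z, w} \<notin> G"
    by (auto simp: insert_commute)
  then show "closed_segment (\<rho> {u, w}) (\<rho> {v, z}) face_of edge_polytope G"
  proof cases
    case 1
    then show ?thesis using rules(1) distinct by auto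
  next
    case 2
    then show ?thesis using rules(2) distinct by (auto simp: insert_commute)
  next
    case 3
    then have "closed_segment (\<rho> {v, z}) (\<rho> {u, w}) face_of edge_polytope G"
      using rules(3) distinct by auto
    then show ?thesis by (simp add: closed_segment_commute)
  next
    case 4
    then have "closed_segment (\<rho> {z, v}) (\<rho> {u, w}) face_of edge_polytope G"
      using rules(4) distinct by auto
    then show ?thesis by (simp add: closed_segment_commute insert_commute)
  qed
qed

lemma card_eq_fibre_times_card_image:
  assumes "finite S" and "\<And>x. x \<in> S \<Longrightarrow> card {y \<in> S. g y = g x} = k"
  shows "card S = k * card (g ` S)"
proof -
  have "card S = (\<Sum>b\<in>g ` S. card {y \<in> S. g y = b})"
    using sum.image_gen[OF assms(1), of "\<lambda>_. 1::nat" g] by simp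
  also have "\<dots> = (\<Sum>b\<in>g ` S. k)"
    using assms(2) by (intro sum.cong) auto
  finally show ?thesis by simp
qed

text \<open>A polytope edge from two meeting edges of \<open>G\<close> arises from 2 cherries, by
  exchanging the tips. One from two disjoint edges arises from 8 tuples, the orbit of the dihedral
  group.\<close>

lemma eight_times_\<epsilon>:
  assumes G: "G \<in> \<Omega>"
  shows "8 * \<epsilon> G = 4 * card (cherries G) + card (unique_matchings G)"
proof -
  define seg where "seg X = convex hull (\<rho> ` X)" for X :: "'a set set"
  have seg: "seg {e, f} = closed_segment (\<rho> e) (\<rho> f)" for e f
    by (simp add: seg_def segment_convex_hull)
  define p where "p = (\<lambda>(v, x, y). {{v, x}, {v, y :: 'a}})"
  define q where "q = (\<lambda>(u, v, w, z). {{u, w}, {v, z :: 'a}})"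
  have "{F. F edge_of edge_polytope G} = seg ` (p ` cherries G \<union> q ` unique_matchings G)"
    (is "?L = ?R")
  proof (intro equalityI subsetI)
    fix F assume "F \<in> ?L"
    then obtain e f where ef: "e \<in> G" "f \<in> G" "e \<noteq> f" "F = seg {e, f}"
      and face: "closed_segment (\<rho> e) (\<rho> f) face_of edge_polytope G"
      unfolding mem_Collect_eq seg by (rule edge_of_edge_polytopeE)
    have c: "card e = 2" "card f = 2" using G ef by (auto simp: simple_graphs_def)
    show "F \<in> ?R"
    proof (cases "e \<inter> f = {}")
      case True
      obtain u w v z where uw: "e = {u, w}" "f = {v, z}" "u \<noteq> w" "v \<noteq> z"
        using c by (auto simp: card_2_iff)
      with True have d: "distinct [u, v, w, z]" by auto
      then have "(u, v, w, z) \<in> unique_matchings G"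
        using unique_matching_face_of_iff[OF G _ _ d] ef(1,2) face uw by (simp add: unique_matchings_def)
      moreover have "F = seg (q (u, v, w, z))" using uw ef(4) by (simp add: q_def)
      ultimately show ?thesis by blast
    next
      case False
      then obtain v where v: "v \<in> e" "v \<in> f" by auto
      obtain x y where x: "e = {v, x}" "x \<noteq> v" and y: "f = {v, y}" "y \<noteq> v"
        using c v by (auto simp: card_2_iff)
      have "(v, x, y) \<in> cherries G" using x y ef by (auto simp: cherries_def)
      moreover have "F = seg (p (v, x, y))" using x y ef(4) by (simp add: p_def)
      ultimately show ?thesis by blast
    qed
  next
    fix F assume "F \<in> ?R"
    then consider v x y where "(v, x, y) \<in> cherries G" "F = seg (p (v, x, y))"
      | u v w z where "(u, v, w, z) \<in> unique_matchings G" "F = seg (q (u, v, w, z))"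
      by auto
    then show "F \<in> ?L"
    proof cases
      case 1
      then have vxy: "{v, x} \<in> G" "{v, y} \<in> G" "v \<noteq> x" "v \<noteq> y" "x \<noteq> y"
        and F: "F = closed_segment (\<rho> {v, x}) (\<rho> {v, y})"
        by (simp_all add: cherries_def p_def seg)
      then have "{v, x} \<noteq> {v, y}" by (simp add: doubleton_eq_iff)
      then have "F edge_of edge_polytope G"
        unfolding F by (intro closed_segment_edge_of cherry_face_of[OF G vxy])
      then show ?thesis by simp
    next
      case 2
      then have uvwz: "{u, w} \<in> G" "{v, z} \<in> G" "distinct [u, v, w, z]"
        and F: "F = closed_segment (\<rho> {u, w}) (\<rho> {v, z})"
        by (simp_all add: unique_matchings_def q_def seg)
      have face: "closed_segment (\<rho> {u, w}) (\<rho> {v, z}) face_of edge_polytope G"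
        using unique_matching_face_of_iff[OF G uvwz] 2(1) by (simp add: unique_matchings_def)
      from uvwz(3) have "{u, w} \<noteq> {v, z}" by (simp add: doubleton_eq_iff)
      then have "F edge_of edge_polytope G"
        unfolding F by (intro closed_segment_edge_of face)
      then show ?thesis by simp
    qed
  qed
  moreover have "inj_on seg (p ` cherries G \<union> q ` unique_matchings G)"
  proof (rule inj_on_subset)
    show "inj_on seg {{e, f} | e f. True}"
    proof (rule inj_onI)
      fix X Y assume "X \<in> {{e, f} | e f. True}" "Y \<in> {{e, f} | e f. True}" and eq: "seg X = seg Y"
      then obtain e f e' f' where X: "X = {e, f}" "Y = {e', f'}" by blast
      then have "\<rho> ` X = \<rho> ` Y" using eq by (simp add: seg closed_segment_eq)
      then show "X = Y" by (simp add: inj_image_eq_iff[OF inj_\<rho>])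
    qed
  qed (auto simp: p_def q_def)
  moreover have "p ` cherries G \<inter> q ` unique_matchings G = {}"
    by (auto simp: p_def q_def cherries_def unique_matchings_def doubleton_eq_iff)
  ultimately have "\<epsilon> G = card (p ` cherries G) + card (q ` unique_matchings G)"
    by (simp add: \<epsilon>_def card_image card_Un_disjoint)
  moreover have "card (cherries G) = 2 * card (p ` cherries G)"
  proof (rule card_eq_fibre_times_card_image)
    fix t assume "t \<in> cherries G"
    then obtain v x y where t: "t = (v, x, y)" "(v, x, y) \<in> cherries G" by (cases t) auto
    then have "{s \<in> cherries G. p s = p t} = {(v, x, y), (v, y, x)}"
      by (auto simp: p_def cherries_def doubleton_eq_iff)
    then show "card {s \<in> cherries G. p s = p t} = 2"
      using t by (simp add: cherries_def)
  qed simp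
  moreover have "card (unique_matchings G) = 8 * card (q ` unique_matchings G)"
  proof (rule card_eq_fibre_times_card_image)
    fix t assume "t \<in> unique_matchings G"
    then obtain u v w z where t: "t = (u, v, w, z)" "(u, v, w, z) \<in> unique_matchings G"
      by (cases t) auto
    have "{s \<in> unique_matchings G. q s = q t} =
        {(u, v, w, z), (w, v, u, z), (u, z, w, v), (w, z, u, v),
         (v, u, z, w), (z, u, v, w), (v, w, z, u), (z, w, v, u)}"
      (is "_ = ?R")
    proof (intro equalityI subsetI)
      fix s assume "s \<in> {s \<in> unique_matchings G. q s = q t}"
      then show "s \<in> ?R" by (cases s) (auto simp: q_def t(1) doubleton_eq_iff)
    next
      fix s assume "s \<in> ?R"
      moreover have "?R \<subseteq> unique_matchings G"
        using unique_matchings_reflect unique_matchings_swap t(2) by blast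
      moreover have "q s = q t" using \<open>s \<in> ?R\<close> by (auto simp: q_def t(1))
      ultimately show "s \<in> {s \<in> unique_matchings G. q s = q t}" by blast
    qed
    then show "card {s \<in> unique_matchings G. q s = q t} = 8"
      using t by (simp add: unique_matchings_def)
  qed simp
  ultimately show ?thesis by simp
qed

subsection \<open>Distributing the counts over the missing edges\<close>

definition nonnbrs :: "'n::finite set set \<Rightarrow> 'n \<Rightarrow> 'n set" where
  "nonnbrs G u = {v. v \<noteq> u \<and> {u, v} \<notin> G}"

lemma mem_nonnbrs_commute: "v \<in> nonnbrs G u \<longleftrightarrow> u \<in> nonnbrs G v"
  by (auto simp: nonnbrs_def insert_commute)

lemma nonnbrs_complete_graph: "nonnbrs complete_graph u = {}"
  by (auto simp: nonnbrs_def complete_graph_def card_2_iff)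

lemma card_plus_card_Compl: "card A + card (- A) = CARD('n)" for A :: "'n::finite set"
  by (metis Compl_disjoint Compl_partition card_Un_disjoint finite)

text \<open>A cherry is a centre together with an ordered pair of distinct neighbours;
  \<open>M v\<close> in the proof is the neighbourhood of \<open>v\<close>.\<close>

lemma card_cherries:
  fixes G :: "'n::finite set set"
  shows "int (card (cherries G)) =
    (\<Sum>v\<in>UNIV. (int CARD('n) - 1 - int (card (nonnbrs G v))) *
                 (int CARD('n) - 2 - int (card (nonnbrs G v))))"
proof -
  define M where "M v = - insert v (nonnbrs G v)" for v
  have M: "int (card (M v)) = int CARD('n) - 1 - int (card (nonnbrs G v))" for v
  proof -
    have "v \<notin> nonnbrs G v" by (simp add: nonnbrs_def)
    moreover have "card (insert v (nonnbrs G v)) + card (M v) = CARD('n)"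
      unfolding M_def by (rule card_plus_card_Compl)
    ultimately show ?thesis by simp
  qed
  have off_diagonal: "int (card (A \<times> A - Id_on A)) = int (card A) * (int (card A) - 1)"
    for A :: "'n set"
  proof -
    have "Id_on A = (\<lambda>x. (x, x)) ` A" by auto
    then have "card (Id_on A) = card A" by (simp add: card_image inj_on_def)
    moreover have "Id_on A \<subseteq> A \<times> A" by auto
    ultimately have "card A \<le> card A * card A" "card (A \<times> A - Id_on A) = card A * card A - card A"
      using card_mono[of "A \<times> A" "Id_on A"] by (auto simp: card_Diff_subset)
    then show ?thesis by (simp add: of_nat_diff algebra_simps)
  qed
  have "cherries G = (SIGMA v:UNIV. M v \<times> M v - Id_on (M v))"
    by (auto simp: cherries_def M_def nonnbrs_def)
  then have "int (card (cherries G)) = (\<Sum>v\<in>UNIV. int (card (M v \<times> M v - Id_on (M v))))"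
    by simp
  also have "\<dots> = (\<Sum>v\<in>UNIV. int (card (M v)) * (int (card (M v)) - 1))"
    by (simp add: off_diagonal)
  finally show ?thesis by (simp add: M algebra_simps)
qed

text \<open>
  For a four-cycle \<open>uvwz\<close> whose diagonals lie in \<open>G\<close>, \<open>weight G u v w z\<close> is the share, in sixteenths,
  of the side \<open>uv\<close> among the missing sides: 8 on a path with two edges, 7, 2, 7 on a path with
  three edges, and 4 on the whole cycle. The charges on the three-edge path are strictly below the bounds
  8 and 4 used for the other configurations, which decides the case of equality.
\<close>
definition weight :: "'n::finite set set \<Rightarrow> 'n \<Rightarrow> 'n \<Rightarrow> 'n \<Rightarrow> 'n \<Rightarrow> int" where
  "weight G u v w z =
    (if distinct [u, v, w, z] \<and> {u, w} \<in> G \<and> {v, z} \<in> G \<and> {u, v} \<notin> G then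
       (if {v, w} \<notin> G \<and> {z, u} \<notin> G then (if {w, z} \<notin> G then 4 else 2)
        else if {v, w} \<notin> G \<or> {z, u} \<notin> G then (if {w, z} \<notin> G then 7 else 8)
        else 0)
     else 0)"

text \<open>The rotations visit the four sides. The shares add up to 8 + 8, 7 + 2 + 7 or four times
  4 in the three unique configurations. With at most one missing side, or just two opposite ones,
  every share is 0.\<close>

lemma sum_weight_rotations:
  "weight G u v w z + weight G v w z u + weight G w z u v + weight G z u v w =
     16 * of_bool ((u, v, w, z) \<in> unique_matchings G)"
proof -
  have sym: "{z, w} = {w, z}" "{w, u} = {u, w}" "{z, v} = {v, z}" by auto
  show ?thesis
    unfolding weight_def unique_matchings_def sym
    by (cases "distinct [u, v, w, z]"; cases "{u, w} \<in> G"; cases "{v, z} \<in> G"; cases "{u, v} \<in> G";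
        cases "{v, w} \<in> G"; cases "{w, z} \<in> G"; cases "{z, u} \<in> G") auto
qed

text \<open>Rotation permutes all tuples, so the four rotated weights have equal totals. Of the
  factor 16, a factor 4 remains.\<close>

lemma card_unique_matchings:
  fixes G :: "'n::finite set set"
  shows "4 * int (card (unique_matchings G)) =
    (\<Sum>u\<in>UNIV. \<Sum>v\<in>UNIV. \<Sum>w\<in>UNIV. \<Sum>z\<in>UNIV. weight G u v w z)"
proof -
  define W where "W f = (\<Sum>t\<in>UNIV. case f t of (u, v, w, z) \<Rightarrow> weight G u v w z)"
    for f :: "'n \<times> 'n \<times> 'n \<times> 'n \<Rightarrow> 'n \<times> 'n \<times> 'n \<times> 'n"
  define r where "r = (\<lambda>(u :: 'n, v :: 'n, w :: 'n, z :: 'n). (v, w, z, u))"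
  have r: "bij r"
    by (rule bij_betw_byWitness[where f' = "\<lambda>(v, w, z, u). (u, v, w, z)"]) (auto simp: r_def)
  have W: "W f = W id" if "bij f" for f
    unfolding W_def using sum.reindex_bij_betw[OF that] by simp
  have "16 * int (card (unique_matchings G)) =
      (\<Sum>t\<in>UNIV. 16 * of_bool (t \<in> unique_matchings G))"
    by (simp add: sum_distrib_left[symmetric])
  also have "\<dots> = W id + W r + W (r \<circ> r) + W (r \<circ> r \<circ> r)"
    unfolding W_def sum.distrib[symmetric]
    by (intro sum.cong) (auto simp: r_def sum_weight_rotations)
  also have "\<dots> = 4 * W id"
    using W[OF r] W[of "r \<circ> r"] W[of "r \<circ> r \<circ> r"] r by (simp add: bij_comp)
  also have "W id = (\<Sum>u\<in>UNIV. \<Sum>v\<in>UNIV. \<Sum>w\<in>UNIV. \<Sum>z\<in>UNIV. weight G u v w z)"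
    by (simp add: W_def sum.cartesian_product case_prod_unfold)
  finally show ?thesis by simp
qed

text \<open>The share of the ordered missing edge \<open>(u, v)\<close> in
  \<open>32 * (\<epsilon> complete_graph - \<epsilon> G)\<close>. In 32, the factor 8 clears the
  tuple multiplicities and the factor 4 the sixteenths left after rotation.\<close>

definition gap :: "'n::finite set set \<Rightarrow> 'n \<Rightarrow> 'n \<Rightarrow> int" where
  "gap G u v = 8 * (4 * int CARD('n) - 6 - int (card (nonnbrs G u)) - int (card (nonnbrs G v)))
     - (\<Sum>w\<in>UNIV. \<Sum>z\<in>UNIV. weight G u v w z)"

lemma sum_nonnbrs_swap:
  "(\<Sum>u\<in>UNIV. \<Sum>v\<in>nonnbrs G u. f u v) = (\<Sum>u\<in>UNIV. \<Sum>v\<in>nonnbrs G u. f v u)"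
proof -
  have nbrs: "{u. v \<in> nonnbrs G u} = nonnbrs G v" for v
    using mem_nonnbrs_commute by auto
  have "(\<Sum>u\<in>UNIV. \<Sum>v\<in>nonnbrs G u. f u v) = (\<Sum>v\<in>UNIV. \<Sum>u | v \<in> nonnbrs G u. f u v)"
    using sum.swap_restrict[of UNIV UNIV f "\<lambda>u v. v \<in> nonnbrs G u"] by simp
  then show ?thesis
    unfolding nbrs .
qed

lemma \<epsilon>_complete_graph_diff:
  fixes G :: "'n::finite set set"
  assumes G: "G \<in> \<Omega>"
  shows "32 * (int (\<epsilon> (complete_graph :: 'n set set)) - int (\<epsilon> G)) =
    (\<Sum>u\<in>UNIV. \<Sum>v\<in>nonnbrs G u. gap G u v)"
proof -
  have scaled_diff: "32 * (x - y) = 16 * (s - t) - 4 * m"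
    if "8 * x = 4 * s" "8 * y = 4 * t + m" for x y s t m :: int
    using that by presburger
  define d where "d = int CARD('n)"
  define k where "k u = int (card (nonnbrs G u))" for u
  have "(complete_graph :: 'n set set) \<in> \<Omega>"
    by (simp add: complete_graph_def simple_graphs_def)
  moreover have "unique_matchings (complete_graph :: 'n set set) = {}"
    by (auto simp: unique_matchings_def complete_graph_def)
  ultimately have "8 * int (\<epsilon> (complete_graph :: 'n set set)) =
      4 * (\<Sum>v\<in>(UNIV :: 'n set). (d - 1) * (d - 2))"
    using eight_times_\<epsilon>[of "complete_graph :: 'n set set"] card_cherries[of "complete_graph :: 'n set set"]
    by (simp add: d_def nonnbrs_complete_graph)
  moreover have "8 * int (\<epsilon> G) =
      4 * (\<Sum>v\<in>UNIV. (d - 1 - k v) * (d - 2 - k v)) + int (card (unique_matchings G))"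
    using eight_times_\<epsilon>[OF G] card_cherries[of G] by (simp add: d_def k_def)
  ultimately have "32 * (int (\<epsilon> (complete_graph :: 'n set set)) - int (\<epsilon> G)) =
     16 * (\<Sum>v\<in>(UNIV :: 'n set). (d - 1) * (d - 2) - (d - 1 - k v) * (d - 2 - k v))
     - 4 * int (card (unique_matchings G))"
    unfolding sum_subtractf by (rule scaled_diff)
  \<comment> \<open>With \<open>k = k v\<close>, the summand factors as
    \<open>k * (2 * d - 3 - k)\<close>, so the loss at a vertex splits evenly over its
    \<open>k\<close> missing edges.\<close>
  also have "(\<Sum>v\<in>(UNIV :: 'n set). (d - 1) * (d - 2) - (d - 1 - k v) * (d - 2 - k v)) =
      (\<Sum>u\<in>UNIV. \<Sum>v\<in>nonnbrs G u. 2 * d - 3 - k u)"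
    by (intro sum.cong) (auto simp: k_def algebra_simps)
  also have "4 * int (card (unique_matchings G)) =
      (\<Sum>u\<in>UNIV. \<Sum>v\<in>nonnbrs G u. \<Sum>w\<in>UNIV. \<Sum>z\<in>UNIV. weight G u v w z)"
    unfolding card_unique_matchings
    by (intro sum.cong refl sum.mono_neutral_right) (auto simp: nonnbrs_def weight_def)
  \<comment> \<open>Half of each charge moves to the reversed edge, which makes the charge symmetric
    in \<open>u\<close> and \<open>v\<close>.\<close>
  also have "16 * (\<Sum>u\<in>UNIV. \<Sum>v\<in>nonnbrs G u. 2 * d - 3 - k u) =
      8 * (\<Sum>u\<in>UNIV. \<Sum>v\<in>nonnbrs G u. 2 * d - 3 - k u) +
      8 * (\<Sum>u\<in>UNIV. \<Sum>v\<in>nonnbrs G u. 2 * d - 3 - k v)"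
    using sum_nonnbrs_swap[where G = G and f = "\<lambda>u v. 2 * d - 3 - k u"] by simp
  also have "\<dots> = (\<Sum>u\<in>UNIV. \<Sum>v\<in>nonnbrs G u. 8 * (4 * d - 6 - k u - k v))"
    unfolding sum_distrib_left sum.distrib[symmetric] by (intro sum.cong) auto
  finally show ?thesis
    unfolding sum_subtractf[symmetric] gap_def d_def k_def .
qed

section \<open>Bounding the gap of a single missing edge\<close>

definition near :: "'n::finite set set \<Rightarrow> 'n \<Rightarrow> 'n \<Rightarrow> 'n set" where
  "near G u v = nonnbrs G u - nonnbrs G v - {v}"

text \<open>If \<open>uv\<close> is missing, each end is a non-neighbour of the other, so neither
  lies in this set. For the same reason \<open>near G u v\<close> has to remove \<open>v\<close>
  explicitly.\<close>

definition far :: "'n::finite set set \<Rightarrow> 'n \<Rightarrow> 'n \<Rightarrow> 'n set" where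
  "far G u v = - (nonnbrs G u \<union> nonnbrs G v)"

definition weight_bound :: "'n::finite set set \<Rightarrow> 'n \<Rightarrow> 'n \<Rightarrow> 'n \<Rightarrow> 'n \<Rightarrow> int" where
  "weight_bound G u v w z =
     8 * (of_bool (w \<in> near G v u) * of_bool (z \<in> far G u v)) +
     8 * (of_bool (w \<in> far G u v) * of_bool (z \<in> near G u v)) +
     4 * (of_bool (w \<in> near G v u) * of_bool (z \<in> near G u v))"

text \<open>As the diagonals \<open>uw\<close> and \<open>vz\<close> must lie in \<open>G\<close>, a
  positive weight puts \<open>w\<close> and \<open>z\<close> into the near and far sets listed. The
  bound is attained for a near and a far vertex iff \<open>wz\<close> is in \<open>G\<close>, and
  for two near vertices iff \<open>wz\<close> is missing.\<close>

lemma weight_le_weight_bound: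
  assumes "v \<in> nonnbrs G u"
  shows "weight G u v w z \<le> weight_bound G u v w z"
  using assms unfolding weight_def weight_bound_def near_def far_def nonnbrs_def
  by (auto simp: insert_commute)

lemma sum_of_bool_mult:
  fixes A B :: "'n::finite set"
  shows "(\<Sum>x\<in>UNIV. \<Sum>y\<in>UNIV. of_bool (x \<in> A) * of_bool (y \<in> B)) = int (card A) * int (card B)"
  unfolding sum_product[symmetric] by simp

lemma sum_weight_bound:
  "(\<Sum>w\<in>UNIV. \<Sum>z\<in>UNIV. weight_bound G u v w z) =
     8 * int (card (far G u v)) * (int (card (near G u v)) + int (card (near G v u))) +
     4 * int (card (near G u v)) * int (card (near G v u))"
  unfolding weight_bound_def sum.distrib sum_distrib_left[symmetric] sum_of_bool_mult
  by (simp add: algebra_simps)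

lemma card_nonnbrs:
  assumes "v \<in> nonnbrs G u"
  shows "card (nonnbrs G u) = card (near G u v) + card (nonnbrs G u \<inter> nonnbrs G v) + 1"
proof -
  have "nonnbrs G u = insert v (near G u v \<union> (nonnbrs G u \<inter> nonnbrs G v))"
    using assms by (auto simp: near_def)
  moreover have "v \<notin> near G u v \<union> (nonnbrs G u \<inter> nonnbrs G v)"
    by (simp add: near_def nonnbrs_def)
  moreover have "near G u v \<inter> (nonnbrs G u \<inter> nonnbrs G v) = {}"
    by (auto simp: near_def)
  ultimately show ?thesis
    by (metis (no_types, lifting) card_Un_disjoint card_insert_disjoint finite Suc_eq_plus1)
qed

lemma card_far:
  fixes G :: "'n::finite set set"
  assumes "v \<in> nonnbrs G u"
  shows "card (near G u v) + card (near G v u) + card (nonnbrs G u \<inter> nonnbrs G v) +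
    card (far G u v) + 2 = CARD('n)"
proof -
  have u: "u \<in> nonnbrs G v" using assms mem_nonnbrs_commute by metis
  have "card (nonnbrs G u \<union> nonnbrs G v) + card (far G u v) = CARD('n)"
    unfolding far_def by (rule card_plus_card_Compl)
  moreover have "card (nonnbrs G u) + card (nonnbrs G v) =
      card (nonnbrs G u \<union> nonnbrs G v) + card (nonnbrs G u \<inter> nonnbrs G v)"
    by (intro card_Un_Int) auto
  ultimately show ?thesis
    using card_nonnbrs[OF assms] card_nonnbrs[OF u] by (simp add: Int_commute)
qed

text \<open>This separates a polynomial in the four cardinalities from the total slack in
  \<open>weight_le_weight_bound\<close>.\<close>

lemma gap_eq:
  fixes G :: "'n::finite set set"
  assumes "v \<in> nonnbrs G u"
  defines "a \<equiv> int (card (near G u v))" and "b \<equiv> int (card (near G v u))"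
    and "c \<equiv> int (card (nonnbrs G u \<inter> nonnbrs G v))" and "z \<equiv> int (card (far G u v))"
  shows "gap G u v = 32 * (int CARD('n) - 2) - 8 * (a + b) - 16 * c - 8 * z * (a + b) - 4 * a * b
      + (\<Sum>w\<in>UNIV. \<Sum>z\<in>UNIV. weight_bound G u v w z - weight G u v w z)"
proof -
  have u: "u \<in> nonnbrs G v" using assms mem_nonnbrs_commute by metis
  show ?thesis
    using card_nonnbrs[OF assms(1)] card_nonnbrs[OF u]
    by (simp add: gap_def sum_subtractf sum_weight_bound Int_commute a_def b_def c_def z_def
        algebra_simps)
qed

text \<open>The critical case is \<open>c = 0\<close>, \<open>z = 12 - s\<close> with
  \<open>s = a + b\<close>. Replacing \<open>a * b\<close> by its maximum \<open>s^2 / 4\<close>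
  turns \<open>g\<close> into \<open>(s - 8) * (7 * s - 48)\<close>, which vanishes at
  \<open>s = 8\<close> and is -1 at \<open>s = 7\<close>. There integrality gives
  \<open>a * b \<le> 12\<close> and lifts the value to 0.\<close>

lemma gap_bound:
  fixes a b c z :: nat
  defines "g \<equiv> 32 * (int a + int b + int c + int z) - 8 * (int a + int b) - 16 * int c
      - 8 * int z * (int a + int b) - 4 * int a * int b"
  assumes le: "a + b + c + z \<le> 12"
  shows "g \<ge> 0"
    and "0 < a + b + c + z \<Longrightarrow> a + b + c + z \<le> 11 \<Longrightarrow> g > 0"
    and "a + b + c + z = 12 \<Longrightarrow> g = 0 \<Longrightarrow>
      c = 0 \<and> (a = 4 \<and> b = 4 \<or> a = 3 \<and> b = 4 \<or> a = 4 \<and> b = 3)"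
proof -
  have a: "a \<in> set [0..<13]" and b: "b \<in> set [0..<13]" using le by auto
  have "g \<ge> 0 \<and> (0 < a + b + c + z \<longrightarrow> a + b + c + z \<le> 11 \<longrightarrow> g > 0) \<and>
    (a + b + c + z = 12 \<longrightarrow> g = 0 \<longrightarrow> c = 0 \<and> (a = 4 \<and> b = 4 \<or> a = 3 \<and> b = 4 \<or> a = 4 \<and> b = 3))"
    \<comment> \<open>Once \<open>a\<close> and \<open>b\<close> are numerals, \<open>g\<close> is
      linear in \<open>c\<close> and \<open>z\<close>.\<close>
    using a b le unfolding g_def by (simp add: upt_rec) (elim disjE; simp; presburger)
  then show "g \<ge> 0"
    and "0 < a + b + c + z \<Longrightarrow> a + b + c + z \<le> 11 \<Longrightarrow> g > 0"
    and "a + b + c + z = 12 \<Longrightarrow> g = 0 \<Longrightarrow>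
      c = 0 \<and> (a = 4 \<and> b = 4 \<or> a = 3 \<and> b = 4 \<or> a = 4 \<and> b = 3)"
    by auto
qed

subsection \<open>Tight missing edges and complete bipartite complements\<close>

lemma gap_cases:
  fixes G :: "'n::finite set set"
  assumes v: "v \<in> nonnbrs G u" and le: "CARD('n) \<le> 14"
  shows "gap G u v \<ge> 0"
    and "3 \<le> CARD('n) \<Longrightarrow> CARD('n) \<le> 13 \<Longrightarrow> gap G u v > 0"
    and "CARD('n) = 14 \<Longrightarrow> gap G u v = 0 \<Longrightarrow>
      nonnbrs G u \<inter> nonnbrs G v = {} \<and>
      (card (nonnbrs G u), card (nonnbrs G v)) \<in> {(5, 5), (4, 5), (5, 4)} \<and>
      (\<forall>w z. weight G u v w z = weight_bound G u v w z)"
proof -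
  define slack where "slack w z = weight_bound G u v w z - weight G u v w z" for w z
  have slack: "slack w z \<ge> 0" for w z
    using weight_le_weight_bound[OF v] by (simp add: slack_def)
  define a b c z where "a = card (near G u v)" and "b = card (near G v u)"
    and "c = card (nonnbrs G u \<inter> nonnbrs G v)" and "z = card (far G u v)"
  define g where "g = 32 * (int a + int b + int c + int z) - 8 * (int a + int b) - 16 * int c
      - 8 * int z * (int a + int b) - 4 * int a * int b"
  have N: "a + b + c + z + 2 = CARD('n)"
    using card_far[OF v] by (simp add: a_def b_def c_def z_def)
  then have "int CARD('n) - 2 = int a + int b + int c + int z" by linarith
  then have gap: "gap G u v = g + (\<Sum>w\<in>UNIV. \<Sum>z\<in>UNIV. slack w z)"
    using gap_eq[OF v] by (simp add: g_def slack_def a_def b_def c_def z_def)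
  have slack_sum: "(\<Sum>w\<in>UNIV. \<Sum>z\<in>UNIV. slack w z) \<ge> 0"
    using slack by (simp add: sum_nonneg)
  have N12: "a + b + c + z \<le> 12" using N le by linarith
  note bound = gap_bound[OF N12, folded g_def]
  show "gap G u v \<ge> 0"
    using bound(1) slack_sum by (simp add: gap)
  show "gap G u v > 0" if "3 \<le> CARD('n)" "CARD('n) \<le> 13"
  proof -
    have "g > 0" using that N by (intro bound(2)) linarith+
    then show ?thesis using slack_sum by (simp add: gap)
  qed
  show "nonnbrs G u \<inter> nonnbrs G v = {} \<and>
      (card (nonnbrs G u), card (nonnbrs G v)) \<in> {(5, 5), (4, 5), (5, 4)} \<and>
      (\<forall>w z. weight G u v w z = weight_bound G u v w z)" if "CARD('n) = 14" "gap G u v = 0"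
  proof -
    have "g = 0" and sum0: "(\<Sum>w\<in>UNIV. \<Sum>z\<in>UNIV. slack w z) = 0"
      using that(2) bound(1) slack_sum by (simp_all add: gap)
    then have abc: "c = 0 \<and> (a = 4 \<and> b = 4 \<or> a = 3 \<and> b = 4 \<or> a = 4 \<and> b = 3)"
      using N that(1) by (intro bound(3)) linarith+
    have u: "u \<in> nonnbrs G v" using v mem_nonnbrs_commute by metis
    \<comment> \<open>The extra 1 is the other end of the missing edge, which turns the sizes 3 and
      4 into 4 and 5.\<close>
    have "card (nonnbrs G u) = a + c + 1" "card (nonnbrs G v) = b + c + 1"
      using card_nonnbrs[OF v] card_nonnbrs[OF u] by (simp_all add: a_def b_def c_def Int_commute)
    moreover have "slack w z = 0" for w z
      using sum0 slack by (simp add: sum_nonneg_eq_0_iff sum_nonneg)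
    ultimately show ?thesis using abc by (auto simp: slack_def c_def)
  qed
qed

lemma weight_eq_nonnbrs:
  "weight G u v w z =
    (if distinct [u, v, w, z] \<and> w \<notin> nonnbrs G u \<and> z \<notin> nonnbrs G v \<and> v \<in> nonnbrs G u then
       (if w \<in> nonnbrs G v \<and> z \<in> nonnbrs G u then (if z \<in> nonnbrs G w then 4 else 2)
        else if w \<in> nonnbrs G v \<or> z \<in> nonnbrs G u then (if z \<in> nonnbrs G w then 7 else 8)
        else 0)
     else 0)"
  by (auto simp: weight_def nonnbrs_def insert_commute)

lemma simple_graph_eqI:
  assumes "G \<in> \<Omega>" "G' \<in> \<Omega>" and eq: "\<And>u. nonnbrs G u = nonnbrs G' u"
  shows "G = G'"
proof (rule set_eqI)
  fix e :: "'a set"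
  show "e \<in> G \<longleftrightarrow> e \<in> G'"
  proof (cases "card e = 2")
    case True
    then obtain x y where "e = {x, y}" "x \<noteq> y" by (auto simp: card_2_iff)
    then show ?thesis using eq[of x] by (auto simp: nonnbrs_def)
  qed (use assms in \<open>auto simp: simple_graphs_def\<close>)
qed

lemma complete_minus_in_simple_graphs: "complete_graph - H \<in> \<Omega>"
  by (simp add: complete_graph_def simple_graphs_def)

lemma ex_nonnbrs:
  assumes "G \<in> \<Omega>" "G \<noteq> complete_graph"
  shows "\<exists>u. nonnbrs G u \<noteq> {}"
  using simple_graph_eqI[OF assms(1) complete_minus_in_simple_graphs[of "{}"]] assms(2)
  by (auto simp: nonnbrs_complete_graph)

section \<open>Removing a complete bipartite graph\<close>

lemma nonnbrs_complete_minus_bipartite: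
  assumes "A \<inter> B = {}"
  shows "nonnbrs (complete_graph - complete_bipartite A B) u =
    (if u \<in> A then B else if u \<in> B then A else {})"
proof -
  have "{u, v} \<in> complete_bipartite A B \<longleftrightarrow> u \<in> A \<and> v \<in> B \<or> u \<in> B \<and> v \<in> A" for v
    by (auto simp: complete_bipartite_def doubleton_eq_iff)
  moreover have "{u, v} \<in> complete_graph" if "v \<noteq> u" for v
    using that by (auto simp: complete_graph_def)
  ultimately show ?thesis
    using assms by (auto simp: nonnbrs_def)
qed

lemma complete_bipartite_commute: "complete_bipartite A B = complete_bipartite B A"
  unfolding complete_bipartite_def by (metis insert_commute)

text \<open>The polynomial of \<open>gap_eq\<close> for the complement \<open>K_{m,n}\<close>: the
  near sets have sizes \<open>m - 1\<close> and \<open>n - 1\<close>, there are no common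
  non-neighbours, and \<open>d - m - n\<close> vertices are far.\<close>

definition bipartite_gap :: "int \<Rightarrow> int \<Rightarrow> int \<Rightarrow> int" where
  "bipartite_gap d m n =
     32 * (d - 2) - 8 * (m + n - 2) - 8 * (d - m - n) * (m + n - 2) - 4 * (m - 1) * (n - 1)"

lemma gap_complete_minus_bipartite_oriented:
  fixes A B :: "'n::finite set"
  defines "G \<equiv> complete_graph - complete_bipartite A B"
  assumes disj: "A \<inter> B = {}" and u: "u \<in> A" and v: "v \<in> B"
  shows "gap G u v = bipartite_gap (int CARD('n)) (int (card A)) (int (card B))"
proof -
  have N: "nonnbrs G x = (if x \<in> A then B else if x \<in> B then A else {})" for x
    unfolding G_def by (rule nonnbrs_complete_minus_bipartite[OF disj])
  have uv: "u \<notin> B" "v \<notin> A" "v \<in> nonnbrs G u" using disj u v by (auto simp: N)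
  have near: "near G u v = B - {v}" "near G v u = A - {u}" "far G u v = - (A \<union> B)"
    using disj u v uv by (auto simp: near_def far_def N)
  have cards: "int (card (B - {v})) = int (card B) - 1" "int (card (A - {u})) = int (card A) - 1"
    using card.remove[OF _ u] card.remove[OF _ v] by simp_all
  have far: "int (card (- (A \<union> B))) = int CARD('n) - int (card A) - int (card B)"
    using card_plus_card_Compl[of "A \<union> B"] disj by (simp add: card_Un_disjoint)
  \<comment> \<open>There is no slack: all pairs between the two sides are missing, and all pairs
    with a far vertex are present.\<close>
  have "weight_bound G u v w z = weight G u v w z" for w z
    unfolding weight_bound_def weight_eq_nonnbrs near
    using disj u v uv by (auto simp: N)
  moreover have "nonnbrs G u \<inter> nonnbrs G v = {}" using disj uv u v by (auto simp: N)
  ultimately show ?thesis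
    using gap_eq[OF uv(3)] unfolding near cards far by (simp add: bipartite_gap_def algebra_simps)
qed

lemma gap_complete_minus_bipartite:
  fixes A B :: "'n::finite set"
  defines "G \<equiv> complete_graph - complete_bipartite A B"
  assumes disj: "A \<inter> B = {}" and v: "v \<in> nonnbrs G u"
  shows "gap G u v = bipartite_gap (int CARD('n)) (int (card A)) (int (card B))"
proof -
  have "u \<in> A \<and> v \<in> B \<or> u \<in> B \<and> v \<in> A"
    using v unfolding G_def by (auto simp: nonnbrs_complete_minus_bipartite[OF disj] split: if_splits)
  then show ?thesis
  proof
    assume "u \<in> A \<and> v \<in> B"
    then show ?thesis using gap_complete_minus_bipartite_oriented[OF disj] by (simp add: G_def)
  next
    assume "u \<in> B \<and> v \<in> A"
    then have "gap G u v = bipartite_gap (int CARD('n)) (int (card B)) (int (card A))"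
      using gap_complete_minus_bipartite_oriented[of B A u v] disj
      by (simp add: G_def complete_bipartite_commute[of A B] Int_commute)
    then show ?thesis by (simp add: bipartite_gap_def algebra_simps)
  qed
qed

text \<open>Zero slack determines the pairs around a missing edge \<open>uv\<close>: near vertices
  of opposite ends are non-adjacent in \<open>G\<close> (\<open>join\<close>), and near and far
  vertices are adjacent (\<open>closed\<close>). The non-neighbourhoods of \<open>u\<close> and
  \<open>v\<close> thus span a complete bipartite component of the complement.\<close>

lemma is_complete_minus_bipartite_if_tight:
  fixes G :: "'n::finite set set"
  assumes G: "G \<in> \<Omega>" "G \<noteq> complete_graph" and d: "CARD('n) = 14"
    and tight: "\<And>u v. v \<in> nonnbrs G u \<Longrightarrow> gap G u v = 0"
  shows "is_complete_minus_bipartite 4 5 G \<or> is_complete_minus_bipartite 5 5 G"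
proof -
  let ?N = "nonnbrs G"
  have le: "CARD('n) \<le> 14" using d by simp
  note sym = mem_nonnbrs_commute[of _ G]
  have disj: "?N u \<inter> ?N v = {}"
    and cards: "(card (?N u), card (?N v)) \<in> {(5, 5), (4, 5), (5, 4)}"
    and weight: "weight G u v w z = weight_bound G u v w z" if "v \<in> ?N u" for u v w z
    using gap_cases(3)[OF that le d tight[OF that]] by blast+
  have join: "z \<in> ?N w" if uv: "v \<in> ?N u" and w: "w \<in> ?N v" and z: "z \<in> ?N u" for u v w z
  proof (cases "w = u \<or> z = v")
    case True
    then show ?thesis using w z sym by auto
  next
    case False
    then have "w \<in> near G v u" "z \<in> near G u v" "w \<notin> far G u v" "z \<notin> far G u v"
      using disj[OF uv] w z by (auto simp: near_def far_def)
    \<comment> \<open>If \<open>wz\<close> were in \<open>G\<close>, the weight would be 2.\<close>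
    then have "weight G u v w z = 4" by (simp add: weight[OF uv] weight_bound_def)
    then show ?thesis by (simp add: weight_eq_nonnbrs split: if_splits)
  qed
  have closed: "y \<notin> ?N w" if uv: "v \<in> ?N u" and w: "w \<in> ?N v" and y: "y \<in> far G u v" for u v w y
  proof (cases "w = u")
    case True
    then show ?thesis using y by (simp add: far_def)
  next
    case False
    then have "w \<in> near G v u" "w \<notin> far G u v" "y \<notin> near G u v"
      using disj[OF uv] w y by (auto simp: near_def far_def)
    \<comment> \<open>If \<open>wy\<close> were missing, the weight would be 7.\<close>
    then have "weight G u v w y = 8" using y by (simp add: weight[OF uv] weight_bound_def)
    then show ?thesis by (simp add: weight_eq_nonnbrs split: if_splits)
  qed
  have comp: "?N w = ?N u" if uv: "v \<in> ?N u" and w: "w \<in> ?N v" for u v w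
  proof (intro equalityI subsetI)
    fix y assume y: "y \<in> ?N w"
    have "v \<in> ?N w" using w sym by blast
    then have "y \<notin> ?N v" using disj[of v w] y by blast
    moreover have "y \<notin> far G u v" using closed[OF uv w] y by blast
    ultimately show "y \<in> ?N u" by (simp add: far_def)
  qed (use join[OF uv w] in blast)
  obtain u v where uv: "v \<in> ?N u"
    using ex_nonnbrs[OF G] by blast
  have vu: "u \<in> ?N v" using uv sym by blast
  have A: "?N p = ?N u" if "p \<in> ?N v" for p using comp[OF uv that] .
  have B: "?N q = ?N v" if "q \<in> ?N u" for q using comp[OF vu that] .
  have far: "?N p = {}" if p: "p \<in> far G u v" for p
  proof (rule ccontr)
    assume "?N p \<noteq> {}"
    then obtain y where y: "y \<in> ?N p" by auto
    have off: "?N x \<inter> (?N u \<union> ?N v) = {}" if "x \<in> far G u v" for x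
    proof (rule equals0I)
      fix q assume "q \<in> ?N x \<inter> (?N u \<union> ?N v)"
      then have "x \<in> ?N q" and "?N q = ?N u \<or> ?N q = ?N v"
        using A B sym by blast+
      then show False using that by (auto simp: far_def)
    qed
    have "y \<in> far G u v" using off[OF p] y by (auto simp: far_def)
    then have "(?N u \<union> ?N v) \<inter> (?N p \<union> ?N y) = {}" using off[OF p] off by blast
    then have "card (?N u \<union> ?N v) + card (?N p \<union> ?N y) \<le> 14"
      using card_mono[of UNIV "(?N u \<union> ?N v) \<union> (?N p \<union> ?N y)"] d by (simp add: card_Un_disjoint)
    \<comment> \<open>A second nontrivial component would require at least 9 + 9 vertices.\<close>
    moreover have "card (?N u \<union> ?N v) \<ge> 9" "card (?N p \<union> ?N y) \<ge> 9"
      using cards[OF uv] cards[OF y] disj[OF uv] disj[OF y] by (auto simp: card_Un_disjoint)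
    ultimately show False by simp
  qed
  have eq: "G = complete_graph - complete_bipartite (?N v) (?N u)"
  proof (rule simple_graph_eqI[OF G(1) complete_minus_in_simple_graphs])
    fix x
    have "?N x = (if x \<in> ?N v then ?N u else if x \<in> ?N u then ?N v else {})"
      using A[of x] B[of x] far[of x] unfolding far_def by (cases "x \<in> ?N v"; cases "x \<in> ?N u") auto
    then show "?N x = nonnbrs (complete_graph - complete_bipartite (?N v) (?N u)) x"
      unfolding nonnbrs_complete_minus_bipartite[OF disj[OF vu]] .
  qed
  then have eq': "G = complete_graph - complete_bipartite (?N u) (?N v)"
    by (simp add: complete_bipartite_commute)
  from cards[OF uv] consider "card (?N u) = 5" "card (?N v) = 5" | "card (?N u) = 4" "card (?N v) = 5"
    | "card (?N v) = 4" "card (?N u) = 5" by auto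
  then show ?thesis
    unfolding is_complete_minus_bipartite_def using eq eq' disj[OF uv] disj[OF vu] by metis
qed

lemma \<epsilon>_eq_if_complete_minus_bipartite:
  fixes G :: "'n::finite set set"
  assumes "is_complete_minus_bipartite m n G"
    and zero: "bipartite_gap (int CARD('n)) (int m) (int n) = 0"
  shows "\<epsilon> G = \<epsilon> (complete_graph :: 'n set set)"
proof -
  obtain A B where AB: "A \<inter> B = {}" "card A = m" "card B = n"
    and G: "G = complete_graph - complete_bipartite A B"
    using assms(1) by (auto simp: is_complete_minus_bipartite_def)
  have "G \<in> \<Omega>" unfolding G by (rule complete_minus_in_simple_graphs)
  moreover have "gap G u v = 0" if "v \<in> nonnbrs G u" for u v
    using gap_complete_minus_bipartite[OF AB(1)] that zero unfolding G AB(2,3) by simp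
  ultimately show ?thesis
    using \<epsilon>_complete_graph_diff[of G] by simp
qed

lemma exists_\<epsilon>_greater:
  assumes "CARD('n::finite) \<ge> 15"
  shows "\<exists>G \<in> (\<Omega> :: 'n set set set). \<epsilon> G > \<epsilon> (complete_graph :: 'n set set)"
proof -
  obtain A :: "'n set" where A: "card A = 5"
    using obtain_subset_with_card_n[of 5 "UNIV :: 'n set"] assms by auto
  have "card (- A) \<ge> 5" using card_plus_card_Compl[of A] assms A by simp
  then obtain B where B: "B \<subseteq> - A" "card B = 5"
    using obtain_subset_with_card_n by metis
  then have disj: "A \<inter> B = {}" by auto
  define G where "G = complete_graph - complete_bipartite A B"
  have G: "G \<in> \<Omega>" unfolding G_def by (rule complete_minus_in_simple_graphs)
  have gap: "gap G u v < 0" if "v \<in> nonnbrs G u" for u v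
  proof -
    \<comment> \<open>For \<open>m = n = 5\<close> the polynomial \<open>bipartite_gap\<close> is
      linear in the dimension and changes sign at 14.\<close>
    have "gap G u v = 32 * (14 - int CARD('n))"
      using gap_complete_minus_bipartite[OF disj] that unfolding G_def A B(2)
      by (simp add: bipartite_gap_def)
    then show ?thesis using assms by simp
  qed
  obtain u where u: "u \<in> A" using A by fastforce
  then have "nonnbrs G u = B"
    unfolding G_def by (simp add: nonnbrs_complete_minus_bipartite[OF disj])
  moreover have "B \<noteq> {}" using B by auto
  ultimately have "(\<Sum>v\<in>nonnbrs G u. - gap G u v) > 0"
    using gap by (intro sum_pos) auto
  then have "(\<Sum>u\<in>UNIV. \<Sum>v\<in>nonnbrs G u. - gap G u v) > 0"
    using gap by (intro sum_pos2[of UNIV u] sum_nonneg) (auto intro: less_imp_le)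
  then have "int (\<epsilon> (complete_graph :: 'n set set)) < int (\<epsilon> G)"
    using \<epsilon>_complete_graph_diff[OF G] by (simp add: sum_negf)
  then show ?thesis using G by auto
qed

theorem theorem0p1:
  fixes d :: nat
  assumes "CARD('n::finite) = d" and "d \<ge> 3"
  shows "(d \<le> 13 \<longrightarrow>
            (\<forall>G \<in> (\<Omega> :: 'n set set set). G \<noteq> complete_graph \<longrightarrow>
               \<epsilon> G < \<epsilon> (complete_graph :: 'n set set))) \<and>
         (d = 14 \<longrightarrow>
            (\<forall>G \<in> (\<Omega> :: 'n set set set). G \<noteq> complete_graph \<longrightarrow>
               \<epsilon> G \<le> \<epsilon> (complete_graph :: 'n set set) \<and>
               (\<epsilon> G = \<epsilon> (complete_graph :: 'n set set) \<longleftrightarrow>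
                  is_complete_minus_bipartite 4 5 G \<or> is_complete_minus_bipartite 5 5 G))) \<and>
         (d \<ge> 15 \<longrightarrow>
            (\<exists>G \<in> (\<Omega> :: 'n set set set). \<epsilon> G > \<epsilon> (complete_graph :: 'n set set)))"
proof (intro conjI impI ballI)
  fix G :: "'n set set"
  assume le: "d \<le> 13" and G: "G \<in> \<Omega>" and ne: "G \<noteq> complete_graph"
  have pos: "gap G u v > 0" if "v \<in> nonnbrs G u" for u v
    using gap_cases(2)[OF that] assms le by simp
  obtain u where "nonnbrs G u \<noteq> {}" using ex_nonnbrs[OF G ne] by blast
  then have "(\<Sum>v\<in>nonnbrs G u. gap G u v) > 0"
    using pos by (intro sum_pos) auto
  then have "(\<Sum>u\<in>UNIV. \<Sum>v\<in>nonnbrs G u. gap G u v) > 0"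
    using pos by (intro sum_pos2[of UNIV u] sum_nonneg) (auto intro: less_imp_le)
  then show "\<epsilon> G < \<epsilon> (complete_graph :: 'n set set)"
    using \<epsilon>_complete_graph_diff[OF G] by simp
next
  fix G :: "'n set set"
  assume d: "d = 14" and G: "G \<in> \<Omega>" and ne: "G \<noteq> complete_graph"
  have nonneg: "gap G u v \<ge> 0" if "v \<in> nonnbrs G u" for u v
    using gap_cases(1)[OF that] assms d by simp
  then have "(\<Sum>u\<in>UNIV. \<Sum>v\<in>nonnbrs G u. gap G u v) \<ge> 0"
    by (intro sum_nonneg)
  then show "\<epsilon> G \<le> \<epsilon> (complete_graph :: 'n set set)"
    using \<epsilon>_complete_graph_diff[OF G] by simp
  show "\<epsilon> G = \<epsilon> (complete_graph :: 'n set set) \<longleftrightarrow>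
    is_complete_minus_bipartite 4 5 G \<or> is_complete_minus_bipartite 5 5 G"
  proof
    assume "\<epsilon> G = \<epsilon> (complete_graph :: 'n set set)"
    then have "(\<Sum>u\<in>UNIV. \<Sum>v\<in>nonnbrs G u. gap G u v) = 0"
      using \<epsilon>_complete_graph_diff[OF G] by simp
    then have "gap G u v = 0" if "v \<in> nonnbrs G u" for u v
      using that nonneg by (auto simp: sum_nonneg_eq_0_iff sum_nonneg)
    then show "is_complete_minus_bipartite 4 5 G \<or> is_complete_minus_bipartite 5 5 G"
      using is_complete_minus_bipartite_if_tight[OF G ne] assms(1) d by blast
  next
    assume "is_complete_minus_bipartite 4 5 G \<or> is_complete_minus_bipartite 5 5 G"
    then show "\<epsilon> G = \<epsilon> (complete_graph :: 'n set set)"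
      \<comment> \<open>In dimension 14 the polynomial vanishes for both pairs: 384 = 56 + 280 + 48
        for sizes 4 and 5, and 384 = 64 + 256 + 64 for sizes 5 and 5.\<close>
      using \<epsilon>_eq_if_complete_minus_bipartite[of 4 5 G] \<epsilon>_eq_if_complete_minus_bipartite[of 5 5 G]
        assms(1) d by (auto simp: bipartite_gap_def)
  qed
next
  assume "d \<ge> 15"
  then show "\<exists>G \<in> (\<Omega> :: 'n set set set). \<epsilon> G > \<epsilon> (complete_graph :: 'n set set)"
    using assms(1) exists_\<epsilon>_greater by blast
qed

end
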